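(* Let $k\geq 2$ and let $T$ be a $(2k+1)$-strong tournament such that every arc of $T$ has a 2-bypass (i.e. for every arc $uv$ of $T$ there is a vertex $w$ with $uw$ and $wv$ arcs of $T$). Then $T$ is $(k+1)^{*}$-strongly connected.
   Context: A tournament is a digraph in which each pair of distinct vertices is joined by exactly one arc. A digraph is $m$-strong if it has more than $m$ vertices and remains strongly connected after deleting any set of fewer than $m$ vertices. For distinct vertices $u,v$ of a digraph $D$, a strong $k^{*}$-container between $u$ and $v$ is a set of $k$ internally disjoint paths that are either all $(u,v)$-paths or all $(v,u)$-paths, whose union contains every vertex of $D$. $D$ is $k^{*}$-strongly connected if there is a strong $k^{*}$-container between every two distinct vertices of $D$. *)

theory Defs
  imports Main
begin

definition tournament :: "'a set \<Rightarrow> ('a \<times> 'a) set \<Rightarrow> bool" where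
  "tournament V A \<longleftrightarrow> finite V \<and> A \<subseteq> V \<times> V \<and> (\<forall>u\<in>V. (u,u) \<notin> A) \<and>
     (\<forall>u\<in>V. \<forall>v\<in>V. u \<noteq> v \<longrightarrow> ((u,v) \<in> A \<longleftrightarrow> (v,u) \<notin> A))"

definition is_path :: "'a set \<Rightarrow> ('a \<times> 'a) set \<Rightarrow> 'a list \<Rightarrow> bool" where
  "is_path V A p \<longleftrightarrow> p \<noteq> [] \<and> distinct p \<and> set p \<subseteq> V \<and>
     (\<forall>i. Suc i < length p \<longrightarrow> (p ! i, p ! Suc i) \<in> A)"

definition is_path_from :: "'a set \<Rightarrow> ('a \<times> 'a) set \<Rightarrow> 'a \<Rightarrow> 'a \<Rightarrow> 'a list \<Rightarrow> bool" where
  "is_path_from V A u v p \<longleftrightarrow> is_path V A p \<and> hd p = u \<and> last p = v"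

definition strongly_connected :: "'a set \<Rightarrow> ('a \<times> 'a) set \<Rightarrow> bool" where
  "strongly_connected V A \<longleftrightarrow> (\<forall>u\<in>V. \<forall>v\<in>V. \<exists>p. is_path_from V A u v p)"

definition m_strong :: "nat \<Rightarrow> 'a set \<Rightarrow> ('a \<times> 'a) set \<Rightarrow> bool" where
  "m_strong m V A \<longleftrightarrow> m < card V \<and>
     (\<forall>S. S \<subseteq> V \<and> card S < m \<longrightarrow> strongly_connected (V - S) (A \<inter> ((V - S) \<times> (V - S))))"

definition interior :: "'a list \<Rightarrow> 'a set" where
  "interior p = set (tl (butlast p))"

definition strong_container :: "nat \<Rightarrow> 'a set \<Rightarrow> ('a \<times> 'a) set \<Rightarrow> 'a \<Rightarrow> 'a \<Rightarrow> 'a list list \<Rightarrow> bool" where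
  "strong_container k V A u v Ps \<longleftrightarrow> length Ps = k \<and> distinct Ps \<and>
     ((\<forall>p\<in>set Ps. is_path_from V A u v p) \<or> (\<forall>p\<in>set Ps. is_path_from V A v u p)) \<and>
     (\<forall>i<k. \<forall>j<k. i \<noteq> j \<longrightarrow> interior (Ps ! i) \<inter> interior (Ps ! j) = {}) \<and>
     (\<Union>p\<in>set Ps. set p) = V"

definition k_star_strongly_connected :: "nat \<Rightarrow> 'a set \<Rightarrow> ('a \<times> 'a) set \<Rightarrow> bool" where
  "k_star_strongly_connected k V A \<longleftrightarrow>
     (\<forall>u\<in>V. \<forall>v\<in>V. u \<noteq> v \<longrightarrow> (\<exists>Ps. strong_container k V A u v Ps))"

definition every_arc_has_2_bypass :: "'a set \<Rightarrow> ('a \<times> 'a) set \<Rightarrow> bool" where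
  "every_arc_has_2_bypass V A \<longleftrightarrow> (\<forall>(u,v)\<in>A. \<exists>w\<in>V. (u,w) \<in> A \<and> (w,v) \<in> A)"

end

theory Submission
  imports Defs
begin

text \<open>
  Let \<open>uv\<close> be an arc. Menger's theorem gives \<open>k + 2\<close> internally disjoint \<open>(u, v)\<close>-paths of length at least
  two. Choose such a system covering as many vertices as possible. No path inside the set \<open>R\<close> of uncovered
  vertices can be inserted into a path of the system; as no single vertex separates the tournament, this
  forces \<open>v \<rightarrow> w \<rightarrow> u\<close> for every \<open>w\<close> in \<open>R\<close>, and \<open>w\<close> dominates an initial segment of every path and is
  dominated by the rest. Contracting the covered inner vertices to one vertex and applying Camion's theorem
  shows that \<open>R\<close> has a Hamiltonian path that starts behind the last inner vertex of some path \<open>P\<close> and ends in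
  front of the first inner vertex of some path \<open>P'\<close>. If \<open>P\<close> and \<open>P'\<close> can be chosen distinct, concatenation
  absorbs \<open>R\<close> at the expense of one path; otherwise the Hamiltonian path can be cut in two and absorbed at
  the expense of two paths. Disjoint \<open>(u, v)\<close>-paths in a tournament can be merged, so exactly \<open>k\<close> spanning
  paths of length at least two can be reached, and the arc \<open>uv\<close> is the last path.
\<close>

subsection \<open>Menger's theorem for directed graphs\<close>

definition walk :: "('a \<times> 'a) set \<Rightarrow> 'a list \<Rightarrow> bool" where
  "walk E p \<longleftrightarrow> p \<noteq> [] \<and> successively (\<lambda>x y. (x, y) \<in> E) p"

text \<open>A one-vertex list is a walk, so a separator contains
  \<open>X \<inter> Y\<close>.\<close>

definition separates :: "('a \<times> 'a) set \<Rightarrow> 'a set \<Rightarrow> 'a set \<Rightarrow> 'a set \<Rightarrow> bool" where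
  "separates E X Y S \<longleftrightarrow> (\<forall>p. walk E p \<and> hd p \<in> X \<and> last p \<in> Y \<longrightarrow> set p \<inter> S \<noteq> {})"

text \<open>Paths are disjoint even at their ends: this is the set version of Menger's theorem,
  applied later with both terminals deleted.\<close>

definition linkage :: "('a \<times> 'a) set \<Rightarrow> 'a set \<Rightarrow> 'a set \<Rightarrow> 'a list set \<Rightarrow> bool" where
  "linkage E X Y F \<longleftrightarrow> finite F \<and> (\<forall>p\<in>F. walk E p \<and> distinct p \<and> hd p \<in> X \<and> last p \<in> Y) \<and>
     pairwise (\<lambda>p q. set p \<inter> set q = {}) F"

lemma walk_mono: "walk E p \<Longrightarrow> E \<subseteq> E' \<Longrightarrow> walk E' p"
  unfolding walk_def by (auto elim: successively_mono)

lemma walk_append: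
  "walk E (p @ q) \<longleftrightarrow> (if p = [] then walk E q else if q = [] then walk E p
     else walk E p \<and> walk E q \<and> (last p, hd q) \<in> E)"
  by (auto simp: walk_def successively_append_iff)

lemma walk_Cons:
  "walk E (x # q) \<longleftrightarrow> q = [] \<or> walk E q \<and> (x, hd q) \<in> E"
  by (cases q) (auto simp: walk_def)

text \<open>The arc \<open>(x, y)\<close> can only be used at an occurrence of \<open>x\<close> that
  has a successor, so \<open>x\<close> may still be the last vertex \<open>z\<close>.\<close>

lemma walk_remove_arc_prefix:
  assumes "walk (insert (x, y) E) (p @ [z])" "x \<notin> set p"
  shows "walk E (p @ [z])"
  using assms by (induction p) (auto simp: walk_Cons)

lemma walk_remove_arc_suffix:
  assumes "walk (insert (x, y) E) (z # p)" "y \<notin> set p"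
  shows "walk E (z # p)"
  using assms by (induction p arbitrary: z) (auto simp: walk_Cons)

lemma walk_to_path:
  assumes "walk E p"
  shows "\<exists>q. walk E q \<and> distinct q \<and> hd q = hd p \<and> last q = last p \<and> set q \<subseteq> set p"
  using assms
proof (induction "length p" arbitrary: p rule: less_induct)
  case less
  show ?case
  proof (cases "distinct p")
    case True
    then show ?thesis using less.prems by blast
  next
    case False
    then obtain xs ys zs y where p: "p = xs @ [y] @ ys @ [y] @ zs"
      using not_distinct_decomp by blast
    let ?p = "xs @ [y] @ zs"
    have "walk E ?p" using less.prems p by (auto simp: walk_append walk_Cons split: if_splits)
    moreover have "hd ?p = hd p" "last ?p = last p" "set ?p \<subseteq> set p" "length ?p < length p"
      using p by (auto simp: hd_append)
    ultimately show ?thesis using less.hyps[of ?p] by (metis order_trans)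
  qed
qed

text \<open>Disjoint paths have distinct last vertices, so by counting \<open>last\<close> is a
  bijection from \<open>F\<close> onto \<open>T\<close>, and the paths can be indexed by
  \<open>T\<close>.\<close>

lemma linkage_card_by_last:
  assumes "linkage E X T F" "finite T" "card F = card T"
  obtains p where "\<And>t. t \<in> T \<Longrightarrow> walk E (p t) \<and> distinct (p t) \<and> hd (p t) \<in> X \<and> last (p t) = t"
    "\<And>s t. s \<in> T \<Longrightarrow> t \<in> T \<Longrightarrow> s \<noteq> t \<Longrightarrow> set (p s) \<inter> set (p t) = {}"
    "\<And>t. t \<in> T \<Longrightarrow> set (p t) \<inter> T = {t}"
proof -
  have F: "\<And>p. p \<in> F \<Longrightarrow> p \<noteq> [] \<and> walk E p \<and> distinct p \<and> hd p \<in> X \<and> last p \<in> T"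
    and disj: "\<And>p q. p \<in> F \<Longrightarrow> q \<in> F \<Longrightarrow> p \<noteq> q \<Longrightarrow> set p \<inter> set q = {}"
    using assms by (auto simp: linkage_def walk_def pairwise_def)
  have inj: "inj_on last F"
    by (rule inj_onI) (metis F disj disjoint_iff last_in_set)
  have "last ` F = T"
    using assms F by (intro card_subset_eq) (auto simp: card_image[OF inj])
  then have "\<forall>t\<in>T. \<exists>p. p \<in> F \<and> last p = t" by auto
  then obtain p where p: "\<And>t. t \<in> T \<Longrightarrow> p t \<in> F \<and> last (p t) = t" by metis
  have d: "set (p s) \<inter> set (p t) = {}" if "s \<in> T" "t \<in> T" "s \<noteq> t" for s t
    using p disj that by metis
  show thesis
  proof
    show "set (p t) \<inter> T = {t}" if "t \<in> T" for t
    proof -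
      have mem: "s \<in> set (p s)" if "s \<in> T" for s
        using p[OF that] F last_in_set by metis
      then show ?thesis using d[OF that] that by blast
    qed
  qed (use p F d in auto)
qed

lemma linkage_card_by_hd:
  assumes "linkage E T Y F" "finite T" "card F = card T"
  obtains p where "\<And>t. t \<in> T \<Longrightarrow> walk E (p t) \<and> distinct (p t) \<and> hd (p t) = t \<and> last (p t) \<in> Y"
    "\<And>s t. s \<in> T \<Longrightarrow> t \<in> T \<Longrightarrow> s \<noteq> t \<Longrightarrow> set (p s) \<inter> set (p t) = {}"
    "\<And>t. t \<in> T \<Longrightarrow> set (p t) \<inter> T = {t}"
proof -
  have F: "\<And>p. p \<in> F \<Longrightarrow> p \<noteq> [] \<and> walk E p \<and> distinct p \<and> hd p \<in> T \<and> last p \<in> Y"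
    and disj: "\<And>p q. p \<in> F \<Longrightarrow> q \<in> F \<Longrightarrow> p \<noteq> q \<Longrightarrow> set p \<inter> set q = {}"
    using assms by (auto simp: linkage_def walk_def pairwise_def)
  have inj: "inj_on hd F"
    by (rule inj_onI) (metis F disj disjoint_iff hd_in_set)
  have "hd ` F = T"
    using assms F by (intro card_subset_eq) (auto simp: card_image[OF inj])
  then have "\<forall>t\<in>T. \<exists>p. p \<in> F \<and> hd p = t" by auto
  then obtain p where p: "\<And>t. t \<in> T \<Longrightarrow> p t \<in> F \<and> hd (p t) = t" by metis
  have d: "set (p s) \<inter> set (p t) = {}" if "s \<in> T" "t \<in> T" "s \<noteq> t" for s t
    using p disj that by metis
  show thesis
  proof
    show "set (p t) \<inter> T = {t}" if "t \<in> T" for t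
    proof -
      have mem: "s \<in> set (p s)" if "s \<in> T" for s
        using p[OF that] F hd_in_set by metis
      then show ?thesis using d[OF that] that by blast
    qed
  qed (use p F d in auto)
qed

text \<open>Goering's proof: if deleting the arc \<open>(x, y)\<close> leaves a separator \<open>S\<close> with fewer than \<open>m\<close> vertices, then
  \<open>S \<union> {x}\<close> and \<open>S \<union> {y}\<close> have exactly \<open>m\<close> elements, and linkages into the former and out of the latter
  meet only in \<open>S\<close>.\<close>

theorem menger:
  assumes "finite E" "finite X"
    and "\<And>S. finite S \<Longrightarrow> separates E X Y S \<Longrightarrow> m \<le> card S"
  shows "\<exists>F. linkage E X Y F \<and> card F = m"
  using assms
proof (induction E arbitrary: X Y rule: finite_induct)
  case empty
  have "separates {} X Y (X \<inter> Y)"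
    unfolding separates_def
  proof (intro allI impI)
    fix p :: "'a list" assume p: "walk {} p \<and> hd p \<in> X \<and> last p \<in> Y"
    then obtain z where "p = [z]" by (cases p) (auto simp: walk_Cons, auto simp: walk_def)
    then show "set p \<inter> (X \<inter> Y) \<noteq> {}" using p by auto
  qed
  then have "m \<le> card (X \<inter> Y)" using empty by blast
  then obtain Z where Z: "Z \<subseteq> X \<inter> Y" "card Z = m" "finite Z"
    by (metis obtain_subset_with_card_n)
  have "linkage {} X Y ((\<lambda>z. [z]) ` Z)"
    using Z by (auto simp: linkage_def walk_def pairwise_def)
  moreover have "card ((\<lambda>z. [z]) ` Z) = m" using Z by (simp add: card_image inj_on_def)
  ultimately show ?case by blast
next
  case (insert e E)
  obtain x y where e: "e = (x, y)" by (cases e)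
  let ?E = "insert (x, y) E"
  show ?case
  proof (cases "\<forall>S. finite S \<longrightarrow> separates E X Y S \<longrightarrow> m \<le> card S")
    case True
    then obtain F where "linkage E X Y F" "card F = m"
      using insert.IH[of X Y] insert.prems by blast
    moreover have "linkage (insert e E) X Y F"
      using \<open>linkage E X Y F\<close> walk_mono[of E _ "insert e E"] by (auto simp: linkage_def)
    ultimately show ?thesis by blast
  next
    case False
    then obtain S where S: "finite S" "separates E X Y S" "card S < m" by auto
    have sepE: "m \<le> card Z" if "finite Z" "separates ?E X Y Z" for Z
      using insert.prems that by (simp add: e)
    \<comment> \<open>A walk avoiding \<open>x\<close> does not use the new arc, so it meets
      \<open>S\<close>. Cut at the first vertex of \<open>insert x S\<close>, the initial piece lies
      in \<open>E\<close>.\<close>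
    have first: "\<exists>p1 z p2. p = p1 @ z # p2 \<and> walk E (p1 @ [z]) \<and> z \<in> insert x S \<and> set p1 \<inter> insert x S = {}"
      if p: "walk ?E p" "hd p \<in> X" "last p \<in> Y" for p
    proof -
      have "\<exists>z\<in>set p. z \<in> insert x S"
      proof (rule ccontr)
        assume "\<not> (\<exists>z\<in>set p. z \<in> insert x S)"
        then have *: "x \<notin> set p" "set p \<inter> S = {}" by auto
        from p(1) obtain p' z where "p = p' @ [z]" by (metis rev_exhaust walk_def)
        with walk_remove_arc_prefix[of x y E p' z] p * have "walk E p" by auto
        then show False using S(2) p *(2) unfolding separates_def by blast
      qed
      then obtain p1 z p2 where "p = p1 @ z # p2" "z \<in> insert x S" "\<forall>w\<in>set p1. w \<notin> insert x S"
        using split_list_first_prop[of p "\<lambda>z. z \<in> insert x S"] by blast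
      moreover from this have "walk ?E (p1 @ [z])" using p(1) walk_append[of ?E "p1 @ [z]" p2]
        by (auto split: if_splits)
      ultimately show ?thesis using walk_remove_arc_prefix[of x y E p1 z] by blast
    qed
    have last: "\<exists>p1 z p2. p = p1 @ z # p2 \<and> walk E (z # p2) \<and> z \<in> insert y S \<and> set p2 \<inter> insert y S = {}"
      if p: "walk ?E p" "hd p \<in> X" "last p \<in> Y" for p
    proof -
      have "\<exists>z\<in>set p. z \<in> insert y S"
      proof (rule ccontr)
        assume "\<not> (\<exists>z\<in>set p. z \<in> insert y S)"
        then have *: "y \<notin> set p" "set p \<inter> S = {}" by auto
        from p(1) obtain p' z where "p = z # p'" by (metis neq_Nil_conv walk_def)
        with walk_remove_arc_suffix[of x y E z p'] p * have "walk E p" by auto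
        then show False using S(2) p *(2) unfolding separates_def by blast
      qed
      then obtain p1 z p2 where "p = p1 @ z # p2" "z \<in> insert y S" "\<forall>w\<in>set p2. w \<notin> insert y S"
        using split_list_last_prop[of p "\<lambda>z. z \<in> insert y S"] by blast
      moreover from this have "walk ?E (z # p2)" using p(1) walk_append[of ?E p1 "z # p2"]
        by (auto split: if_splits)
      ultimately show ?thesis using walk_remove_arc_suffix[of x y E z p2] by blast
    qed
    have "separates ?E X Y (insert x S)" unfolding separates_def using first by fastforce
    then have cx: "m \<le> card (insert x S)" using sepE S by blast
    have "separates ?E X Y (insert y S)" unfolding separates_def using last by fastforce
    then have cy: "m \<le> card (insert y S)" using sepE S by blast
    have xS: "x \<notin> S" "card (insert x S) = m" and yS: "y \<notin> S" "card (insert y S) = m"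
      using cx cy S by (auto simp: card_insert_if split: if_splits)
    \<comment> \<open>By \<open>first\<close>, anything that separates \<open>X\<close> from
      \<open>insert x S\<close> in \<open>E\<close> also separates \<open>X\<close> from
      \<open>Y\<close> in \<open>?E\<close>.\<close>
    have "m \<le> card Z" if Z: "finite Z" "separates E X (insert x S) Z" for Z
    proof (rule sepE[OF Z(1)], unfold separates_def, intro allI impI)
      fix p assume p: "walk ?E p \<and> hd p \<in> X \<and> last p \<in> Y"
      then obtain p1 z p2 where *: "p = p1 @ z # p2" "walk E (p1 @ [z])" "z \<in> insert x S"
        using first by blast
      moreover have "hd (p1 @ [z]) \<in> X" using p * by (cases p1) auto
      ultimately have "set (p1 @ [z]) \<inter> Z \<noteq> {}" using Z(2) unfolding separates_def
        by (metis last_snoc)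
      then show "set p \<inter> Z \<noteq> {}" using * by auto
    qed
    then obtain F1 where F1: "linkage E X (insert x S) F1" "card F1 = m"
      using insert.IH[of X "insert x S"] insert.prems by blast
    have "m \<le> card Z" if Z: "finite Z" "separates E (insert y S) Y Z" for Z
    proof (rule sepE[OF Z(1)], unfold separates_def, intro allI impI)
      fix p assume p: "walk ?E p \<and> hd p \<in> X \<and> last p \<in> Y"
      then obtain p1 z p2 where *: "p = p1 @ z # p2" "walk E (z # p2)" "z \<in> insert y S"
        using last by blast
      moreover have "last (z # p2) \<in> Y" using p * by auto
      ultimately have "set (z # p2) \<inter> Z \<noteq> {}" using Z(2) unfolding separates_def
        by (metis list.sel(1))
      then show "set p \<inter> Z \<noteq> {}" using * by auto
    qed
    then obtain F2 where F2: "linkage E (insert y S) Y F2" "card F2 = m"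
      using insert.IH[of "insert y S" Y] S by blast
    obtain p where p: "\<And>t. t \<in> insert x S \<Longrightarrow> walk E (p t) \<and> distinct (p t) \<and> hd (p t) \<in> X \<and> last (p t) = t"
      and pd: "\<And>s t. s \<in> insert x S \<Longrightarrow> t \<in> insert x S \<Longrightarrow> s \<noteq> t \<Longrightarrow> set (p s) \<inter> set (p t) = {}"
      and pS: "\<And>t. t \<in> insert x S \<Longrightarrow> set (p t) \<inter> insert x S = {t}"
      using linkage_card_by_last[OF F1(1)] F1 S xS by (metis finite_insert)
    obtain q where q: "\<And>t. t \<in> insert y S \<Longrightarrow> walk E (q t) \<and> distinct (q t) \<and> hd (q t) = t \<and> last (q t) \<in> Y"
      and qd: "\<And>s t. s \<in> insert y S \<Longrightarrow> t \<in> insert y S \<Longrightarrow> s \<noteq> t \<Longrightarrow> set (q s) \<inter> set (q t) = {}"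
      and qS: "\<And>t. t \<in> insert y S \<Longrightarrow> set (q t) \<inter> insert y S = {t}"
      using linkage_card_by_hd[OF F2(1)] F2 S yS by (metis finite_insert)
    \<comment> \<open>Following \<open>p s\<close> up to \<open>z\<close> and then
      \<open>q t\<close> gives a walk in \<open>E\<close> from \<open>X\<close> to \<open>Y\<close>,
      which meets \<open>S\<close>. As \<open>p s\<close> meets \<open>S\<close> at most at its end
      and \<open>q t\<close> at most at its start, only \<open>z\<close> itself can lie in
      \<open>S\<close>.\<close>
    have cross: "z \<in> S \<and> z = s \<and> z = t"
      if st: "s \<in> insert x S" "t \<in> insert y S" and z: "z \<in> set (p s)" "z \<in> set (q t)" for s t z
    proof -
      obtain p1 p2 where ps: "p s = p1 @ z # p2" using z(1) by (meson split_list)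
      obtain q1 q2 where qt: "q t = q1 @ z # q2" using z(2) by (meson split_list)
      have "walk E (p1 @ z # q2)" using p[OF st(1)] q[OF st(2)] ps qt
        by (auto simp: walk_append walk_Cons split: if_splits)
      moreover have "hd (p1 @ z # q2) \<in> X" using p[OF st(1)] ps by (cases p1) auto
      moreover have "last (p1 @ z # q2) \<in> Y" using q[OF st(2)] qt by auto
      ultimately obtain c where c: "c \<in> set (p1 @ z # q2)" "c \<in> S"
        using S(2) unfolding separates_def by blast
      have "c \<notin> set p1"
      proof
        assume "c \<in> set p1"
        then have "c = s" using pS[OF st(1)] c(2) ps by auto
        then have "c = last (z # p2)" using p[OF st(1)] ps by auto
        then show False using \<open>c \<in> set p1\<close> p[OF st(1)] ps last_in_set[of "z # p2"] by auto
      qed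
      moreover have "c \<notin> set q2"
      proof
        assume "c \<in> set q2"
        then have "c = t" using qS[OF st(2)] c(2) qt by auto
        then have "c = hd (q1 @ [z])" using q[OF st(2)] qt by (cases q1) auto
        then show False using \<open>c \<in> set q2\<close> q[OF st(2)] qt hd_in_set[of "q1 @ [z]"] by auto
      qed
      ultimately have "z \<in> S" using c by auto
      then show ?thesis using pS[OF st(1)] qS[OF st(2)] z by auto
    qed
    \<comment> \<open>The path into \<open>x\<close> continues along the new arc with the path out
      of \<open>y\<close>. For any other \<open>s\<close> both paths contain \<open>s\<close>, and
      \<open>tl\<close> drops the second copy.\<close>
    define f where "f s = (if s = x then y else s)" for s
    define r where "r s = (if s = x then p x @ q y else p s @ tl (q s))" for s
    have f: "f s \<in> insert y S" if "s \<in> insert x S" for s using that by (auto simp: f_def)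
    have f_inj: "f s \<noteq> f t" if "s \<in> insert x S" "t \<in> insert x S" "s \<noteq> t" for s t
      using that yS by (auto simp: f_def)
    have tlq: "q s = s # tl (q s)" if "s \<in> S" for s
      using q[of s] that by (cases "q s") (auto simp: walk_def)
    have last_p: "last (p s) = s" "p s \<noteq> []" if "s \<in> insert x S" for s
      using p[OF that] by (auto simp: walk_def)
    have set_r: "set (r s) = set (p s) \<union> set (q (f s))" if "s \<in> insert x S" for s
    proof (cases "s = x")
      case False
      then have "set (q s) = insert s (set (tl (q s)))" using tlq that by (metis insertE list.simps(15))
      then show ?thesis using False last_in_set[OF last_p(2)[OF that]] last_p(1)[OF that]
        by (auto simp: r_def f_def)
    qed (auto simp: r_def f_def)
    have r: "walk ?E (r s) \<and> distinct (r s) \<and> hd (r s) \<in> X \<and> last (r s) \<in> Y"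
      if s: "s \<in> insert x S" for s
    proof (cases "s = x")
      case True
      have 1: "walk E (p x)" "distinct (p x)" "hd (p x) \<in> X" "last (p x) = x" "p x \<noteq> []"
        using p[of x] by (auto simp: walk_def)
      have 2: "walk E (q y)" "distinct (q y)" "hd (q y) = y" "last (q y) \<in> Y" "q y \<noteq> []"
        using q[of y] by (auto simp: walk_def)
      have "set (p x) \<inter> set (q y) = {}" using cross[of x y] xS by auto
      then show ?thesis using 1 2 True walk_mono[OF 1(1), of ?E] walk_mono[OF 2(1), of ?E]
        by (auto simp: r_def walk_append)
    next
      case False
      then have sS: "s \<in> S" using s by simp
      have 1: "walk E (p s)" "distinct (p s)" "hd (p s) \<in> X" "last (p s) = s" "p s \<noteq> []"
        using p[OF s] by (auto simp: walk_def)
      have 2: "walk E (s # tl (q s))" "distinct (s # tl (q s))" "last (s # tl (q s)) \<in> Y"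
        using q[of s] sS tlq[OF sS] by auto
      have "z = s" if "z \<in> set (p s)" "z \<in> set (tl (q s))" for z
        using cross[of s s z] that sS tlq[OF sS] by (metis insertCI list.set_intros(2))
      then have "set (p s) \<inter> set (tl (q s)) = {}" using 2 by auto
      then show ?thesis
        using 1 2 False walk_mono[OF 1(1), of ?E] walk_mono[OF 2(1), of ?E]
        by (auto simp: r_def walk_append walk_Cons split: if_splits)
    qed
    have disj: "set (r s) \<inter> set (r t) = {}"
      if st: "s \<in> insert x S" "t \<in> insert x S" "s \<noteq> t" for s t
    proof -
      have "set (p s) \<inter> set (q (f t)) = {}"
        if st: "s \<in> insert x S" "t \<in> insert x S" "s \<noteq> t" for s t
      proof (rule ccontr)
        assume "set (p s) \<inter> set (q (f t)) \<noteq> {}"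
        then obtain z where "z \<in> S" "z = s" "z = f t" using cross[OF st(1) f[OF st(2)]] by blast
        then show False using st xS(1) yS(1) by (auto simp: f_def split: if_splits)
      qed
      then show ?thesis
        using pd[OF st] qd[OF f[OF st(1)] f[OF st(2)] f_inj[OF st]] st
        by (auto simp: set_r)
    qed
    have "inj_on r (insert x S)"
    proof (rule inj_onI, rule ccontr)
      fix s t assume "s \<in> insert x S" "t \<in> insert x S" "r s = r t" "s \<noteq> t"
      then show False using disj[of s t] r[of s] by (auto simp: walk_def)
    qed
    then have "card (r ` insert x S) = m" using xS by (simp only: card_image)
    moreover have "linkage ?E X Y (r ` insert x S)"
      unfolding linkage_def
    proof (intro conjI ballI pairwiseI)
      show "finite (r ` insert x S)" using S by simp
    next
      fix a b assume "a \<in> r ` insert x S" "b \<in> r ` insert x S" "a \<noteq> b"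
      then show "set a \<inter> set b = {}" using disj by (metis imageE)
    qed (use r in \<open>metis imageE\<close>)+
    ultimately show ?thesis using e by blast
  qed
qed

subsection \<open>Hamiltonian paths and merging in tournaments\<close>

lemma successivelyI:
  assumes "\<And>xs x y ys. p = xs @ x # y # ys \<Longrightarrow> P x y"
  shows "successively P p"
  using assms
proof (induction p rule: induct_list012)
  case (3 x y p)
  have "successively P (y # p)"
    by (rule 3(2)) (metis 3(3) append_Cons)
  then show ?case using 3(3)[of "[]"] by simp
qed auto

lemma successively_imp_hd:
  "successively (\<lambda>x y. Q x \<longrightarrow> Q y) p \<Longrightarrow> Q (hd p) \<Longrightarrow> x \<in> set p \<Longrightarrow> Q x"
  by (induction p rule: induct_list012) auto

lemma successively_imp_last:
  "successively (\<lambda>x y. Q x \<longrightarrow> Q y) p \<Longrightarrow> x \<in> set p \<Longrightarrow> Q x \<Longrightarrow> Q (last p)"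
  by (induction p arbitrary: x rule: induct_list012) (auto, blast+)

text \<open>\<open>X\<close> and \<open>Y\<close> are the out- and in-neighbours of an imagined extra vertex; the hypotheses say that adding
  it to the tournament \<open>R\<close> gives a strong semicomplete digraph, and the conclusion is Camion's theorem for
  that digraph.\<close>

lemma ham_between:
  fixes arc :: "'a \<Rightarrow> 'a \<Rightarrow> bool"
  assumes "finite R" "R \<noteq> {}" "X \<subseteq> R" "Y \<subseteq> R" "X \<union> Y = R"
    and total: "\<And>x y. x \<in> R \<Longrightarrow> y \<in> R \<Longrightarrow> x \<noteq> y \<Longrightarrow> arc x y \<or> arc y x"
    and asym: "\<And>x y. arc x y \<Longrightarrow> \<not> arc y x"
    and enter: "\<And>Z. Z \<subseteq> R \<Longrightarrow> Z \<noteq> {} \<Longrightarrow> Z \<inter> X = {} \<Longrightarrow> \<exists>x\<in>R - Z. \<exists>z\<in>Z. arc x z"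
    and leave: "\<And>Z. Z \<subseteq> R \<Longrightarrow> Z \<noteq> {} \<Longrightarrow> Z \<inter> Y = {} \<Longrightarrow> \<exists>z\<in>Z. \<exists>y\<in>R - Z. arc z y"
  shows "\<exists>p. p \<noteq> [] \<and> distinct p \<and> set p = R \<and> successively arc p \<and> hd p \<in> X \<and> last p \<in> Y"
proof -
  \<comment> \<open>A longest path from \<open>X\<close> to \<open>Y\<close> inside \<open>R\<close>
    will turn out to be spanning.\<close>
  define good where "good p \<longleftrightarrow> p \<noteq> [] \<and> distinct p \<and> set p \<subseteq> R \<and> successively arc p \<and> hd p \<in> X \<and> last p \<in> Y"
    for p
  have "\<exists>p. good p"
  proof (cases "X \<inter> Y = {}")
    case True
    have "X \<noteq> {}" using enter[of R] assms(2) by auto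
    then obtain x y where "x \<in> X" "y \<in> R - X" "arc x y" using leave[of X] assms(3) True by auto
    then have "good [x, y]" using assms by (auto simp: good_def)
    then show ?thesis ..
  next
    case False
    then obtain x where "x \<in> X \<inter> Y" by auto
    then have "good [x]" using assms by (auto simp: good_def)
    then show ?thesis ..
  qed
  moreover have "length p \<le> card R" if "good p" for p
    using that assms(1) by (metis card_mono distinct_card good_def)
  ultimately obtain p where p: "good p" and longest: "\<And>q. good q \<Longrightarrow> length q \<le> length p"
    using ex_has_greatest_nat[of good _ length "Suc (card R)"] by (metis less_Suc_eq_le)
  have p': "p \<noteq> []" "distinct p" "set p \<subseteq> R" "successively arc p" "hd p \<in> X" "last p \<in> Y"
    using p by (auto simp: good_def)
  have hd_p: "hd p \<in> set p" "hd p \<in> R" using p'(1,3) hd_in_set by auto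
  have insertion: "successively (\<lambda>x y. arc x w \<longrightarrow> arc y w) p" if w: "w \<in> R - set p" for w
  proof (rule successivelyI, rule impI, rule ccontr)
    fix xs x y ys assume p_eq: "p = xs @ x # y # ys" and "arc x w" "\<not> arc y w"
    then have "arc w y" using total[of w y] w p'(3) by auto
    then have "good (xs @ x # w # y # ys)" using p' w p_eq \<open>arc x w\<close>
      by (auto simp: good_def successively_append_iff successively_Cons hd_append)
    then show False using longest[of "xs @ x # w # y # ys"] p_eq by simp
  qed
  \<comment> \<open>\<open>w\<close> can be put neither before nor after \<open>p\<close>, and its
    in-neighbours on \<open>p\<close> form a final segment; so it dominates all of \<open>p\<close>
    or is dominated by all of it.\<close>
  have outside: "w \<in> X - Y \<and> (\<forall>x\<in>set p. \<not> arc w x) \<or> w \<in> Y - X \<and> (\<forall>x\<in>set p. \<not> arc x w)" if w: "w \<in> R - set p"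
    for w
  proof -
    have fwd: "arc (hd p) w \<Longrightarrow> \<forall>x\<in>set p. arc x w" "\<And>x. x \<in> set p \<Longrightarrow> arc x w \<Longrightarrow> arc (last p) w"
      using successively_imp_hd[OF insertion[OF w]] successively_imp_last[OF insertion[OF w]] by auto
    have "\<not> good (w # p)" "\<not> good (p @ [w])"
      using longest[of "w # p"] longest[of "p @ [w]"] by auto
    then have ends: "arc w (hd p) \<Longrightarrow> w \<notin> X" "arc (last p) w \<Longrightarrow> w \<notin> Y"
      using p' w by (auto simp: good_def successively_Cons successively_append_iff)
    have "arc w (hd p) \<or> arc (hd p) w" using total[of w "hd p"] w hd_p by auto
    then show ?thesis using ends fwd asym assms(5) w p'(1) by (metis DiffD1 DiffI UnE last_in_set)
  qed
  have "R \<subseteq> set p"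
  proof (rule ccontr)
    assume "\<not> R \<subseteq> set p"
    \<comment> \<open>\<open>Z\<close> consists of the missed vertices dominated by all of \<open>p\<close>, the other missed ones dominate \<open>p\<close>;
      an arc \<open>(z, y)\<close> between the two kinds yields the longer path \<open>z # y # p\<close>.\<close>
    define Z where "Z = (R - set p) \<inter> X"
    show False
    proof (cases "Z = {}")
      case True
      \<comment> \<open>All missed vertices now lie outside \<open>X\<close> and so dominate
        \<open>p\<close>, yet an arc must enter them from \<open>p\<close>.\<close>
      then show False using enter[of "R - set p"] outside \<open>\<not> R \<subseteq> set p\<close>
        by (auto simp: Z_def)
    next
      case False
      moreover have "Z \<inter> Y = {}" using outside by (auto simp: Z_def)
      ultimately obtain z y where zy: "z \<in> Z" "y \<in> R - Z" "arc z y" using leave[of Z] Z_def by blast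
      then have y: "y \<in> R - set p" "y \<in> Y - X" "\<not> arc (hd p) y" 
        using outside[of z] outside[of y] p'(1) by (auto simp: Z_def)
      then have "arc y (hd p)" using total[of y "hd p"] hd_p by auto
      then have "good (z # y # p)" using p' zy y by (auto simp: good_def Z_def successively_Cons)
      then show False using longest[of "z # y # p"] by simp
    qed
  qed
  then show ?thesis using p' by blast
qed

text \<open>As in merge sort, of the two first vertices the one dominating the other goes first and
  becomes the new common start \<open>a\<close>.\<close>

lemma merge_paths:
  assumes total: "\<And>x y. x \<in> set P \<Longrightarrow> y \<in> set Q \<Longrightarrow> arc x y \<or> arc y x"
    and "distinct P" "distinct Q" "set P \<inter> set Q = {}"
    and "successively arc (a # P @ [b])" "successively arc (a # Q @ [b])"
  shows "\<exists>N. distinct N \<and> set N = set P \<union> set Q \<and> successively arc (a # N @ [b])"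
  using assms
proof (induction "length P + length Q" arbitrary: a P Q rule: less_induct)
  case less
  consider "P = []" | "Q = []" | p P' q Q' where "P = p # P'" "Q = q # Q'"
    by (metis neq_Nil_conv)
  then show ?case
  proof cases
    case 3
    consider "arc p q" | "arc q p" using less.prems(1)[of p q] 3 by auto
    then show ?thesis
    proof cases
      case 1
      have "\<exists>N. distinct N \<and> set N = set P' \<union> set Q \<and> successively arc (p # N @ [b])"
        by (rule less.hyps) (use less.prems 3 1 in auto)
      then obtain N where "distinct N" "set N = set P' \<union> set Q" "successively arc (p # N @ [b])" by blast
      then show ?thesis using less.prems 3 by (intro exI[of _ "p # N"]) auto
    next
      case 2
      have "\<exists>N. distinct N \<and> set N = set P \<union> set Q' \<and> successively arc (q # N @ [b])"
        by (rule less.hyps) (use less.prems 3 2 in auto)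
      then obtain N where "distinct N" "set N = set P \<union> set Q'" "successively arc (q # N @ [b])" by blast
      then show ?thesis using less.prems 3 by (intro exI[of _ "q # N"]) auto
    qed
  qed (use less.prems in auto)
qed

lemma rtrancl_walk:
  assumes "(x, y) \<in> E\<^sup>*"
  shows "\<exists>p. walk E p \<and> distinct p \<and> hd p = x \<and> last p = y"
proof -
  have "\<exists>p. walk E p \<and> hd p = x \<and> last p = y"
    using assms
  proof (induction rule: rtrancl_induct)
    case base
    then show ?case by (intro exI[of _ "[x]"]) (auto simp: walk_Cons)
  next
    case (step y z)
    then obtain p where "walk E p" "hd p = x" "last p = y" by blast
    then show ?case using step(2)
      by (intro exI[of _ "p @ [z]"]) (auto simp: walk_append walk_Cons hd_append, auto simp: walk_def)
  qed
  then show ?thesis using walk_to_path by metis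
qed

lemma walk_vertices: "walk E p \<Longrightarrow> E \<subseteq> R \<times> R \<Longrightarrow> hd p \<in> R \<Longrightarrow> set p \<subseteq> R"
  by (induction p) (auto simp: walk_Cons)

subsection \<open>Systems of disjoint paths between two terminals\<close>

text \<open>The last two assumptions are reachability in cut form: without \<open>u\<close> every
  vertex still reaches \<open>v\<close>, and without \<open>v\<close> every vertex is still reached
  from \<open>u\<close>.\<close>

locale terminals =
  fixes V :: "'a set" and A :: "('a \<times> 'a) set" and u v :: 'a
  assumes tour: "tournament V A" and uv: "u \<in> V" "v \<in> V" "u \<noteq> v"
    and leave_avoiding_u: "\<And>X. X \<subseteq> V - {u} \<Longrightarrow> X \<noteq> {} \<Longrightarrow> v \<notin> X \<Longrightarrow> \<exists>x\<in>X. \<exists>y\<in>V - {u} - X. (x, y) \<in> A"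
    and enter_avoiding_v: "\<And>X. X \<subseteq> V - {v} \<Longrightarrow> X \<noteq> {} \<Longrightarrow> u \<notin> X \<Longrightarrow> \<exists>y\<in>V - {v} - X. \<exists>x\<in>X. (y, x) \<in> A"
begin

abbreviation arc :: "'a \<Rightarrow> 'a \<Rightarrow> bool" where
  "arc x y \<equiv> (x, y) \<in> A"

text \<open>A path from \<open>u\<close> to \<open>v\<close> of length at least two is represented by the list of its inner vertices.\<close>

definition route :: "'a list \<Rightarrow> bool" where
  "route P \<longleftrightarrow> P \<noteq> [] \<and> distinct P \<and> set P \<subseteq> V - {u, v} \<and> successively arc (u # P @ [v])"

definition system :: "'a list set \<Rightarrow> bool" where
  "system F \<longleftrightarrow> finite F \<and> (\<forall>P\<in>F. route P) \<and> pairwise (\<lambda>P Q. set P \<inter> set Q = {}) F"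

definition cover :: "'a list set \<Rightarrow> 'a set" where
  "cover F = (\<Union>P\<in>F. set P)"

definition optimal :: "'a list set \<Rightarrow> bool" where
  "optimal F \<longleftrightarrow> system F \<and> (\<forall>F'. system F' \<and> card F' = card F \<longrightarrow> card (cover F') \<le> card (cover F))"

lemma finite_V: "finite V"
  using tour by (simp add: tournament_def)

lemma arc_total: "x \<in> V \<Longrightarrow> y \<in> V \<Longrightarrow> x \<noteq> y \<Longrightarrow> arc x y \<or> arc y x"
  using tour unfolding tournament_def by metis

lemma arc_asym:
  assumes "arc x y"
  shows "\<not> arc y x"
proof -
  have "x \<in> V" "y \<in> V" using tour assms unfolding tournament_def by auto
  then show ?thesis using tour assms unfolding tournament_def by metis
qed

lemma route_iff:
  "route P \<longleftrightarrow> P \<noteq> [] \<and> distinct P \<and> set P \<subseteq> V - {u, v} \<and> arc u (hd P) \<and> successively arc P \<and> arc (last P) v"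
  by (auto simp: route_def successively_append_iff successively_Cons)

lemma optimal_system: "optimal F \<Longrightarrow> system F"
  by (simp add: optimal_def)

lemma system_route: "system F \<Longrightarrow> P \<in> F \<Longrightarrow> route P"
  by (simp add: system_def)

lemma system_cover: "system F \<Longrightarrow> cover F \<subseteq> V - {u, v}"
  by (auto simp: system_def cover_def route_def)

text \<open>Bookkeeping shared by insertion, merging and absorption. Beyond the vertices of
  \<open>G\<close>, \<open>N\<close> uses only uncovered ones, so it stays disjoint from the
  remaining routes.\<close>

lemma replace_routes:
  assumes F: "system F" and G: "G \<subseteq> F" "G \<noteq> {}" and N: "route N"
    and covers: "cover G \<subseteq> set N" "set N \<inter> cover F \<subseteq> cover G"
  shows "system (insert N (F - G))" "cover (insert N (F - G)) = cover F \<union> set N"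
    "card (insert N (F - G)) + card G = card F + 1"
proof -
  have disj: "set P \<inter> set Q = {}" if "P \<in> F" "Q \<in> F" "P \<noteq> Q" for P Q
    using F that by (auto simp: system_def pairwise_def)
  have N_disj: "set P \<inter> set N = {}" if "P \<in> F - G" for P
  proof -
    have "set P \<inter> cover G = {}" using disj that G(1) by (auto simp: cover_def)
    moreover have "set P \<subseteq> cover F" using that by (auto simp: cover_def)
    ultimately show ?thesis using covers(2) by blast
  qed
  show "system (insert N (F - G))"
    using F N N_disj by (auto simp: system_def pairwise_insert intro: pairwise_subset)
  show "cover (insert N (F - G)) = cover F \<union> set N"
    using covers(1) G(1) by (auto simp: cover_def)
  have "N \<notin> F - G" using N_disj[of N] N by (auto simp: route_def)
  moreover have "finite F" "finite G" using F G finite_subset by (auto simp: system_def)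
  ultimately show "card (insert N (F - G)) + card G = card F + 1"
    using G by (simp add: card_Diff_subset card_mono)
qed

text \<open>Splitting \<open>P\<close> with both terminals attached allows the gap to lie right
  behind \<open>u\<close> or right before \<open>v\<close> as well.\<close>

lemma insert_path:
  assumes F: "system F" "P \<in> F" and P: "u # P @ [v] = xs @ x # y # ys"
    and q: "q \<noteq> []" "distinct q" "set q \<subseteq> V - {u, v} - cover F" "successively arc q"
    and arcs: "arc x (hd q)" "arc (last q) y"
  shows "\<exists>F'. system F' \<and> card F' = card F \<and> cover F' = cover F \<union> set q"
proof -
  obtain P1 where P1: "xs @ [x] = u # P1" using P by (cases xs) auto
  obtain P2 where P2: "y # ys = P2 @ [v]"
    using P by (metis append_butlast_last_id last.simps last_append last_snoc list.distinct(1) append_is_Nil_conv)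
  have "u # P @ [v] = (u # P1) @ (P2 @ [v])" using P P1 P2 by (metis append.assoc append_Cons append_Nil)
  then have P_eq: "P = P1 @ P2" by simp
  have ends: "last (u # P1) = x" "hd (P2 @ [v]) = y" using P1 P2 by (metis last_snoc, metis list.sel(1))
  have route_P: "route P" using F by (auto simp: system_def)
  let ?N = "P1 @ q @ P2"
  have set_P: "set P \<subseteq> cover F" using F by (auto simp: cover_def)
  have succ: "successively arc (u # P1)" "successively arc (P2 @ [v])"
    using route_P P_eq successively_append_iff[of arc "u # P1" "P2 @ [v]"] by (auto simp: route_def)
  have "successively arc ((u # P1) @ q @ (P2 @ [v]))"
    using succ q arcs ends by (simp only: successively_append_iff) auto
  moreover have "distinct ?N" using route_P q set_P unfolding P_eq route_def by auto
  moreover have "set ?N \<subseteq> V - {u, v}" using route_P q(3) unfolding P_eq route_def by auto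
  ultimately have N: "route ?N" using q(1) by (auto simp: route_def)
  have "cover {P} \<subseteq> set ?N" "set ?N \<inter> cover F \<subseteq> cover {P}"
    using q(3) by (auto simp: cover_def P_eq)
  from replace_routes[OF F(1) _ _ N this]
  have "system (insert ?N (F - {P}))" "cover (insert ?N (F - {P})) = cover F \<union> set ?N"
    "card (insert ?N (F - {P})) = card F"
    using F(2) by auto
  moreover have "cover F \<union> set ?N = cover F \<union> set q" using set_P P_eq by auto
  ultimately show ?thesis by metis
qed

section \<open>Vertices missed by an optimal system\<close>

lemma optimal_no_insertion:
  assumes F: "optimal F" "P \<in> F" and P: "u # P @ [v] = xs @ x # y # ys"
    and q: "q \<noteq> []" "distinct q" "set q \<subseteq> V - {u, v} - cover F" "successively arc q"
    and arcs: "arc x (hd q)" "arc (last q) y"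
  shows False
proof -
  have sys: "system F" by (rule optimal_system[OF F(1)])
  obtain F' where F': "system F'" "card F' = card F" "cover F' = cover F \<union> set q"
    using insert_path[OF sys F(2) P q arcs] by blast
  have "cover F \<subset> cover F'" using F'(3) q(1,3) hd_in_set[OF q(1)] by blast
  moreover have "finite (cover F')" using system_cover[OF F'(1)] finite_V by (meson finite_Diff finite_subset)
  ultimately have "card (cover F) < card (cover F')" by (rule psubset_card_mono[rotated])
  moreover have "card (cover F') \<le> card (cover F)" using F(1) F' unfolding optimal_def by blast
  ultimately show False by simp
qed

text \<open>If \<open>x\<close> dominates \<open>w\<close> and the next vertex \<open>y\<close> does
  not, then \<open>w\<close> dominates \<open>y\<close> and fits between them.\<close>

lemma optimal_uncovered_monotone:
  assumes F: "optimal F" "P \<in> F" and w: "w \<in> V - {u, v} - cover F"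
  shows "successively (\<lambda>x y. arc x w \<longrightarrow> arc y w) (u # P @ [v])"
proof (rule successivelyI, rule impI, rule ccontr)
  fix xs x y ys assume P: "u # P @ [v] = xs @ x # y # ys" and "arc x w" "\<not> arc y w"
  have "route P" by (rule system_route[OF optimal_system[OF F(1)] F(2)])
  moreover have "y \<in> set (u # P @ [v])" unfolding P by simp
  ultimately have "y \<in> V" "y \<noteq> w"
    using w uv F(2) by (auto simp: route_def cover_def)
  then have "arc w y" using arc_total[of w y] w \<open>\<not> arc y w\<close> by auto
  then show False
    using \<open>arc x w\<close> w by (intro optimal_no_insertion[OF F P, of "[w]"]) simp_all
qed

text \<open>Otherwise monotonicity makes every vertex of every route dominate \<open>w\<close>. Some
  arc avoiding \<open>u\<close> leaves the set reachable from \<open>w\<close> inside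
  \<open>R\<close>; its head \<open>y\<close> is on a route or is \<open>v\<close>. A path from
  \<open>w\<close> to the tail of that arc then fits between \<open>y\<close> and its
  predecessor.\<close>

lemma optimal_uncovered_to_u:
  assumes F: "optimal F" "F \<noteq> {}" and w: "w \<in> V - {u, v} - cover F"
  shows "arc w u"
proof (rule ccontr)
  assume "\<not> arc w u"
  then have "arc u w" using arc_total[of u w] uv w by auto
  define R where "R = V - {u, v} - cover F"
  let ?E = "A \<inter> R \<times> R"
  define X where "X = {z. (w, z) \<in> ?E\<^sup>*}"
  have "z \<in> R" if "(w, z) \<in> ?E\<^sup>*" for z
    using that w by (cases rule: rtranclE) (auto simp: R_def)
  then have X: "w \<in> X" "X \<subseteq> R" by (auto simp: X_def)
  then obtain z y where zy: "z \<in> X" "y \<in> V - {u} - X" "arc z y"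
    using leave_avoiding_u[of X] by (auto simp: R_def)
  have "y \<notin> R"
  proof
    assume "y \<in> R"
    then have "(z, y) \<in> ?E" using zy X by auto
    then show False using zy rtrancl_into_rtrancl[of w z ?E y] by (simp add: X_def)
  qed
  \<comment> \<open>If \<open>y = v\<close>, any route will do, since \<open>v\<close> follows them
    all.\<close>
  then obtain P where P: "P \<in> F" "y \<in> set (P @ [v])" using zy F(2) by (auto simp: R_def cover_def)
  then obtain ps ys where ps: "P @ [v] = ps @ y # ys" by (meson split_list)
  obtain xs x where xs: "u # ps = xs @ [x]" by (metis rev_exhaust list.distinct(1))
  have "u # P @ [v] = (u # ps) @ y # ys" using ps by simp
  also have "\<dots> = xs @ x # y # ys" unfolding xs by simp
  finally have split: "u # P @ [v] = xs @ x # y # ys" .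
  have "x \<in> set (u # P @ [v])" unfolding split by simp
  then have "arc x w"
    by (rule successively_imp_hd[OF optimal_uncovered_monotone[OF F(1) P(1) w], rotated])
      (simp add: \<open>arc u w\<close>)
  obtain q where q: "walk ?E q" "distinct q" "hd q = w" "last q = z"
    using rtrancl_walk[of w z ?E] zy(1) unfolding X_def by auto
  then have "set q \<subseteq> R" using walk_vertices[of ?E q R] w by (auto simp: R_def)
  moreover have "q \<noteq> []" "successively arc q" using q(1) walk_mono[of ?E q A] by (auto simp: walk_def)
  ultimately show False
    using q(2-4) \<open>arc x w\<close> zy(3) unfolding R_def
    by (intro optimal_no_insertion[OF F(1) P(1) split, of q]) simp_all
qed

text \<open>Mirror image: if \<open>v\<close> does not dominate \<open>w\<close>, no vertex of a
  route does. A path of uncovered vertices ending in \<open>w\<close> then fits between the vertex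
  \<open>y\<close> from which it is entered and the successor of \<open>y\<close>.\<close>

lemma optimal_uncovered_from_v:
  assumes F: "optimal F" "F \<noteq> {}" and w: "w \<in> V - {u, v} - cover F"
  shows "arc v w"
proof (rule ccontr)
  assume "\<not> arc v w"
  define R where "R = V - {u, v} - cover F"
  let ?E = "A \<inter> R \<times> R"
  define X where "X = {z. (z, w) \<in> ?E\<^sup>*}"
  have "z \<in> R" if "(z, w) \<in> ?E\<^sup>*" for z
    using that w by (cases rule: converse_rtranclE) (auto simp: R_def)
  then have X: "w \<in> X" "X \<subseteq> R" by (auto simp: X_def)
  then obtain z y where zy: "z \<in> X" "y \<in> V - {v} - X" "arc y z"
    using enter_avoiding_v[of X] by (auto simp: R_def)
  have "y \<notin> R"
  proof
    assume "y \<in> R"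
    then have "(y, z) \<in> ?E" using zy X by auto
    then show False using zy converse_rtrancl_into_rtrancl[of y z ?E w] by (simp add: X_def)
  qed
  then obtain P where P: "P \<in> F" "y \<in> set (u # P)" using zy F(2) by (auto simp: R_def cover_def)
  then obtain xs ps where ps: "u # P = xs @ y # ps" by (meson split_list)
  obtain x ys where x: "ps @ [v] = x # ys" by (cases "ps @ [v]") auto
  have "u # P @ [v] = (u # P) @ [v]" by simp
  also have "\<dots> = xs @ y # (ps @ [v])" unfolding ps by simp
  finally have split: "u # P @ [v] = xs @ y # x # ys" unfolding x .
  have "route P" by (rule system_route[OF optimal_system[OF F(1)] P(1)])
  have "x \<in> set (u # P @ [v])" unfolding split by auto
  have "arc (last (u # P @ [v])) w" if "arc x w"
    by (rule successively_imp_last[OF optimal_uncovered_monotone[OF F(1) P(1) w] \<open>x \<in> set (u # P @ [v])\<close>])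
      (fact that)
  then have "\<not> arc x w" using \<open>\<not> arc v w\<close> by auto
  moreover have "x \<in> V" "x \<noteq> w"
    using \<open>x \<in> set (u # P @ [v])\<close> \<open>route P\<close> w uv P(1) by (auto simp: route_def cover_def)
  ultimately have "arc w x" using arc_total[of x w] w by blast
  obtain q where q: "walk ?E q" "distinct q" "hd q = z" "last q = w"
    using rtrancl_walk[of z w ?E] zy(1) unfolding X_def by auto
  then have "set q \<subseteq> R" using walk_vertices[of ?E q R] X zy by auto
  moreover have "q \<noteq> []" "successively arc q" using q(1) walk_mono[of ?E q A] by (auto simp: walk_def)
  ultimately show False
    using q(2-4) \<open>arc w x\<close> zy(3) unfolding R_def
    by (intro optimal_no_insertion[OF F(1) P(1) split, of q]) simp_all
qed

text \<open>\<open>ham_between\<close> with the covered vertices contracted. The arcs it requires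
  cannot come from \<open>u\<close> or go to \<open>v\<close>, because uncovered vertices dominate
  \<open>u\<close> and are dominated by \<open>v\<close>.\<close>

lemma optimal_uncovered_hamiltonian:
  assumes F: "optimal F" "F \<noteq> {}" and R: "R = V - {u, v} - cover F" "R \<noteq> {}"
  shows "\<exists>p. p \<noteq> [] \<and> distinct p \<and> set p = R \<and> successively arc p \<and>
    (\<exists>P\<in>F. arc (last P) (hd p)) \<and> (\<exists>P\<in>F. arc (last p) (hd P))"
proof -
  have route: "route P" if "P \<in> F" for P using system_route[OF optimal_system[OF F(1)] that] .
  have total: "arc x r \<or> arc r x" if "r \<in> R" "P \<in> F" "x \<in> set P" for r P x
    using that route[of P] arc_total[of x r] R by (auto simp: route_def cover_def)
  have mono: "successively (\<lambda>x y. arc x r \<longrightarrow> arc y r) P" if "r \<in> R" "P \<in> F" for r P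
    using optimal_uncovered_monotone[OF F(1) that(2), of r] that(1) R
    by (auto simp: successively_Cons successively_append_iff)
  define X where "X = {r\<in>R. \<exists>P\<in>F. arc (last P) r}"
  define Y where "Y = {r\<in>R. \<exists>P\<in>F. arc r (hd P)}"
  \<comment> \<open>By monotonicity an arc from anywhere on a route yields one from its last vertex;
    dually for \<open>Y_I\<close> and the first vertex.\<close>
  have X_I: "r \<in> X" if "r \<in> R" "P \<in> F" "x \<in> set P" "arc x r" for r P x
    using successively_imp_last[OF mono] that by (auto simp: X_def)
  have Y_I: "r \<in> Y" if "r \<in> R" "P \<in> F" "x \<in> set P" "arc r x" for r P x
  proof -
    have "\<not> arc (hd P) r" using successively_imp_hd[OF mono] that arc_asym by blast
    moreover have "hd P \<in> set P" using route[OF that(2)] by (auto simp: route_def)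
    ultimately show ?thesis using total that by (auto simp: Y_def)
  qed
  have "\<exists>p. p \<noteq> [] \<and> distinct p \<and> set p = R \<and> successively arc p \<and> hd p \<in> X \<and> last p \<in> Y"
  proof (rule ham_between)
    show "finite R" using R finite_V by auto
    show "X \<union> Y = R"
    proof
      show "R \<subseteq> X \<union> Y"
      proof
        fix r assume "r \<in> R"
        obtain P where "P \<in> F" using F by blast
        moreover have "hd P \<in> set P" using route[OF \<open>P \<in> F\<close>] by (auto simp: route_def)
        ultimately show "r \<in> X \<union> Y" using total X_I Y_I \<open>r \<in> R\<close> by blast
      qed
    qed (auto simp: X_def Y_def)
    show "arc x y \<or> arc y x" if "x \<in> R" "y \<in> R" "x \<noteq> y" for x y
      using arc_total[of x y] that R by auto
    show "\<exists>x\<in>R - Z. \<exists>z\<in>Z. arc x z" if Z: "Z \<subseteq> R" "Z \<noteq> {}" "Z \<inter> X = {}" for Z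
    proof -
      obtain x z where xz: "x \<in> V - {v} - Z" "z \<in> Z" "arc x z"
        using enter_avoiding_v[of Z] Z R by auto
      have "x \<noteq> u" using optimal_uncovered_to_u[OF F, of z] xz Z R arc_asym by blast
      moreover have "x \<notin> cover F" using X_I xz Z unfolding cover_def by blast
      ultimately show ?thesis using xz R by blast
    qed
    show "\<exists>z\<in>Z. \<exists>y\<in>R - Z. arc z y" if Z: "Z \<subseteq> R" "Z \<noteq> {}" "Z \<inter> Y = {}" for Z
    proof -
      obtain z y where zy: "y \<in> V - {u} - Z" "z \<in> Z" "arc z y"
        using leave_avoiding_u[of Z] Z R by auto
      have "y \<noteq> v" using optimal_uncovered_from_v[OF F, of z] zy Z R arc_asym by blast
      moreover have "y \<notin> cover F" using Y_I zy Z unfolding cover_def by blast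
      ultimately show ?thesis using zy R by blast
    qed
  qed (use R arc_asym in \<open>auto simp: X_def Y_def\<close>)
  then show ?thesis by (auto simp: X_def Y_def)
qed

text \<open>One route is lost if the ends of the Hamiltonian path attach to different routes.
  Otherwise three routes are fused into one, which costs two and is why \<open>card F\<close> is at
  least 3.\<close>

lemma optimal_absorb:
  assumes F: "optimal F" "3 \<le> card F"
  shows "\<exists>F'. system F' \<and> cover F' = V - {u, v} \<and> card F \<le> card F' + 2"
proof (cases "V - {u, v} \<subseteq> cover F")
  case True
  then show ?thesis using system_cover[of F] optimal_system[OF F(1)] by (intro exI[of _ F]) auto
next
  case False
  define R where "R = V - {u, v} - cover F"
  have sys: "system F" by (rule optimal_system[OF F(1)])
  have route: "route P" if "P \<in> F" for P using sys that by (auto simp: system_def)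
  have disj: "set P \<inter> set Q = {}" if "P \<in> F" "Q \<in> F" "P \<noteq> Q" for P Q
    using sys that by (auto simp: system_def pairwise_def)
  have F_ne: "F \<noteq> {}" using F by auto
  obtain p P P' where p: "p \<noteq> []" "distinct p" "set p = R" "successively arc p"
    and P: "P \<in> F" "arc (last P) (hd p)" and P': "P' \<in> F" "arc (last p) (hd P')"
    using optimal_uncovered_hamiltonian[OF F(1) F_ne R_def] False R_def by auto
  have R_disj: "set Q \<inter> R = {}" if "Q \<in> F" for Q using that by (auto simp: R_def cover_def)
  have R_V: "R \<subseteq> V - {u, v}" "cover F \<union> R = V - {u, v}"
    using system_cover[OF sys] by (auto simp: R_def)
  show ?thesis
  proof (cases "\<exists>P\<in>F. \<exists>Q\<in>F. P \<noteq> Q \<and> arc (last P) (hd p) \<and> arc (last p) (hd Q)")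
    case True
    then obtain P Q where PQ: "P \<in> F" "Q \<in> F" "P \<noteq> Q" "arc (last P) (hd p)" "arc (last p) (hd Q)"
      by blast
    let ?N = "P @ p @ Q"
    have N: "route ?N"
      using route[OF PQ(1)] route[OF PQ(2)] p disj[OF PQ(1-3)] R_disj[OF PQ(1)] R_disj[OF PQ(2)] PQ(4,5) R_V
      by (auto simp: route_iff successively_append_iff hd_append)
    have "cover {P, Q} \<subseteq> set ?N" "set ?N \<inter> cover F \<subseteq> cover {P, Q}"
      using p(3) by (auto simp: cover_def R_def)
    note replaced = replace_routes[OF sys _ _ N this]
    have "set P \<subseteq> cover F" "set Q \<subseteq> cover F" using PQ by (auto simp: cover_def)
    then have "cover F \<union> set ?N = V - {u, v}" using R_V(2) p(3) by auto
    then have "system (insert ?N (F - {P, Q}))" "cover (insert ?N (F - {P, Q})) = V - {u, v}"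
      "card (insert ?N (F - {P, Q})) + 2 = card F + 1"
      using replaced PQ(1-3) by simp_all
    then show ?thesis by (intro exI[of _ "insert ?N (F - {P, Q})"]) auto
  next
    case False
    \<comment> \<open>The negated case first gives \<open>P' = P\<close>; any other route attached
      to an end of \<open>p\<close> would then form a forbidden pair with \<open>P\<close>.\<close>
    have only_P: "\<not> arc (last Q) (hd p)" "\<not> arc (last p) (hd Q)" if "Q \<in> F" "Q \<noteq> P" for Q
      using False P P' that by metis+
    \<comment> \<open>Only \<open>P\<close> connects to the ends of \<open>p\<close>. Cut \<open>p\<close> behind its last vertex \<open>r\<close> that precedes another
      route \<open>Q'\<close>; what comes after \<open>r\<close> can follow any third route \<open>Q\<close>, and the two pieces are absorbed
      in the order \<open>Q, zs, P, ys r, Q'\<close>.\<close>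
    have "P' = P" using only_P P' by blast
    have total: "arc x r \<or> arc r x" if "r \<in> R" "Q \<in> F" "x \<in> set Q" for r Q x
      using that route[of Q] arc_total[of x r] R_disj[of Q] R_V by (auto simp: route_def)
    have mono: "arc (last Q) r" if "r \<in> R" "Q \<in> F" "arc (hd Q) r" for r Q
    proof -
      have monotone: "successively (\<lambda>x y. arc x r \<longrightarrow> arc y r) Q"
        using optimal_uncovered_monotone[OF F(1) that(2), of r] that(1)
        by (auto simp: R_def successively_Cons successively_append_iff)
      show ?thesis
        by (rule successively_imp_hd[OF monotone that(3)]) (use route[OF that(2)] in \<open>simp add: route_def\<close>)
    qed
    have dichotomy: "arc (last Q) r \<or> arc r (hd Q)" if "r \<in> R" "Q \<in> F" for r Q
    proof -
      have "hd Q \<in> set Q" using route[OF that(2)] by (simp add: route_def)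
      then show ?thesis using total[OF that] mono[OF that] by blast
    qed
    have ends: "hd p \<in> R" "last p \<in> R" using p by auto
    have "\<not> F \<subseteq> {P}" using F(2) card_mono[of "{P}" F] by auto
    \<comment> \<open>The first vertex of \<open>p\<close> qualifies: no route but \<open>P\<close>
      has an arc from its last vertex to it, so the dichotomy applies.\<close>
    then have "\<exists>r\<in>set p. \<exists>Q\<in>F - {P}. arc r (hd Q)"
      using dichotomy[OF ends(1)] only_P ends(1) p(3) by blast
    then obtain ys r zs where split: "p = ys @ r # zs" and r: "\<exists>Q\<in>F - {P}. arc r (hd Q)"
      and zs: "\<forall>z\<in>set zs. \<not> (\<exists>Q\<in>F - {P}. arc z (hd Q))"
      using split_list_last_prop[of p "\<lambda>r. \<exists>Q\<in>F - {P}. arc r (hd Q)"] by blast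
    obtain Q' where Q': "Q' \<in> F" "Q' \<noteq> P" "arc r (hd Q')" using r by blast
    have "zs \<noteq> []" using Q' only_P split by auto
    have "\<not> F \<subseteq> {P, Q'}" using F(2) card_mono[of "{P, Q'}" F] Q' by auto
    then obtain Q where Q: "Q \<in> F" "Q \<noteq> P" "Q \<noteq> Q'" by blast
    \<comment> \<open>By the choice of \<open>r\<close>, \<open>hd zs\<close> does not dominate
      \<open>hd Q\<close>, so the dichotomy gives this arc.\<close>
    have "arc (last Q) (hd zs)"
      using dichotomy[of "hd zs" Q] zs Q \<open>zs \<noteq> []\<close> split p(3) by auto
    have "arc (last zs) (hd P)" using P' \<open>P' = P\<close> split \<open>zs \<noteq> []\<close> by auto
    define ys' where "ys' = ys @ [r]"
    have ys': "p = ys' @ zs" "ys' \<noteq> []" "arc (last P) (hd ys')" "arc (last ys') (hd Q')"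
      using P(2) Q' split by (auto simp: ys'_def hd_append)
    let ?N = "Q @ zs @ P @ ys' @ Q'"
    have succ: "successively arc ys'" "successively arc zs" "distinct ys'" "distinct zs"
      "set ys' \<inter> set zs = {}" "set ys' \<union> set zs = R"
      using p ys' by (auto simp: successively_append_iff)
    have "set ys' \<subseteq> R" "set zs \<subseteq> R" using succ by auto
    then have "distinct ?N"
      using route[OF P(1)] route[OF Q(1)] route[OF Q'(1)] disj[OF P(1) Q(1)] disj[OF P(1) Q'(1)] disj[OF Q(1) Q'(1)]
        Q Q' R_disj[OF P(1)] R_disj[OF Q(1)] R_disj[OF Q'(1)] succ
      unfolding route_def distinct_append by auto
    then have N: "route ?N"
      using route[OF P(1)] route[OF Q(1)] route[OF Q'(1)] succ R_V \<open>zs \<noteq> []\<close> ys'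
        \<open>arc (last Q) (hd zs)\<close> \<open>arc (last zs) (hd P)\<close>
      by (auto simp: route_iff successively_append_iff hd_append)
    have "cover {P, Q, Q'} \<subseteq> set ?N" "set ?N \<inter> cover F \<subseteq> cover {P, Q, Q'}"
      using succ(6) by (auto simp: cover_def R_def)
    note replaced = replace_routes[OF sys _ _ N this]
    have "system (insert ?N (F - {P, Q, Q'}))" "cover (insert ?N (F - {P, Q, Q'})) = cover F \<union> set ?N"
      "card (insert ?N (F - {P, Q, Q'})) + card {P, Q, Q'} = card F + 1"
      using replaced P(1) Q(1) Q'(1) by simp_all
    moreover have "set P \<subseteq> cover F" "set Q \<subseteq> cover F" "set Q' \<subseteq> cover F"
      using P(1) Q(1) Q'(1) by (auto simp: cover_def)
    then have "cover F \<union> set ?N = V - {u, v}" using R_V(2) succ(6) by auto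
    moreover have "card {P, Q, Q'} = 3" using Q Q' by auto
    ultimately show ?thesis by (intro exI[of _ "insert ?N (F - {P, Q, Q'})"]) auto
  qed
qed

section \<open>Reaching the exact number of routes\<close>

lemma optimal_exists:
  assumes "system F"
  shows "\<exists>F'. optimal F' \<and> card F' = card F"
proof -
  have "card (cover F') < Suc (card V)" if "system F'" for F'
    using system_cover[OF that] finite_V by (metis Diff_subset card_mono le_imp_less_Suc subset_trans)
  then obtain F' where "system F'" "card F' = card F"
    "\<And>F''. system F'' \<Longrightarrow> card F'' = card F \<Longrightarrow> card (cover F'') \<le> card (cover F')"
    using ex_has_greatest_nat[of "\<lambda>F'. system F' \<and> card F' = card F" F "\<lambda>F'. card (cover F')" "Suc (card V)"] assms
    by blast
  then show ?thesis unfolding optimal_def by metis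
qed

lemma merge_routes:
  assumes "system F" "1 \<le> m" "m \<le> card F"
  shows "\<exists>F'. system F' \<and> cover F' = cover F \<and> card F' = m"
  using assms
proof (induction "card F" arbitrary: F)
  case 0
  then show ?case by auto
next
  case (Suc n)
  show ?case
  proof (cases "m = card F")
    case True
    then show ?thesis using Suc by blast
  next
    case False
    then have "2 \<le> card F" using Suc.prems by auto
    then obtain P Q where PQ: "P \<in> F" "Q \<in> F" "P \<noteq> Q"
      by (metis One_nat_def card_le_Suc0_iff_eq card.infinite not_less_eq_eq numeral_2_eq_2 zero_le_one Suc_n_not_le_n)
    have routes: "route P" "route Q" and disj: "set P \<inter> set Q = {}"
      using Suc.prems(1) PQ by (auto simp: system_def pairwise_def)
    have "\<exists>N. distinct N \<and> set N = set P \<union> set Q \<and> successively arc (u # N @ [v])"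
    proof (rule merge_paths[OF _ _ _ disj])
      fix x y assume "x \<in> set P" "y \<in> set Q"
      then show "arc x y \<or> arc y x" using arc_total[of x y] routes disj by (auto simp: route_def)
    qed (use routes in \<open>auto simp: route_def\<close>)
    then obtain N where N: "distinct N" "set N = set P \<union> set Q" "successively arc (u # N @ [v])" by blast
    then have "route N" using routes by (auto simp: route_def)
    note * = replace_routes[OF Suc.prems(1) _ _ this, of "{P, Q}"]
    let ?F = "insert N (F - {P, Q})"
    have F': "system ?F" "cover ?F = cover F" "card ?F = n"
      using * N(2) PQ Suc(2) by (auto simp: cover_def)
    then show ?thesis using Suc.hyps(1)[of ?F] Suc.prems Suc.hyps(2) False by auto
  qed
qed

text \<open>Absorption may cost two routes, hence the start from \<open>m + 2\<close>; any surplus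
  is merged away.\<close>

lemma spanning_system:
  assumes "system F" "1 \<le> m" "card F = m + 2"
  shows "\<exists>F'. system F' \<and> cover F' = V - {u, v} \<and> card F' = m"
proof -
  obtain F1 where "optimal F1" "card F1 = m + 2" using optimal_exists[OF assms(1)] assms(3) by auto
  then obtain F2 where "system F2" "cover F2 = V - {u, v}" "m \<le> card F2"
    using optimal_absorb[of F1] assms(2) by auto
  then show ?thesis using merge_routes[of F2 m] assms(2) by auto
qed

end

subsection \<open>Containers\<close>

lemma is_path_iff:
  "is_path V A p \<longleftrightarrow> walk A p \<and> distinct p \<and> set p \<subseteq> V"
  by (auto simp: is_path_def walk_def successively_conv_nth)

section \<open>Cut conditions and disjoint routes from strong connectivity\<close>

lemma m_strong_walk:
  assumes "m_strong m V A" "S \<subseteq> V" "card S < m" "x \<in> V - S" "y \<in> V - S"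
  obtains p where "walk A p" "distinct p" "set p \<subseteq> V - S" "hd p = x" "last p = y"
proof -
  obtain p where "is_path_from (V - S) (A \<inter> (V - S) \<times> (V - S)) x y p"
    using assms unfolding m_strong_def strongly_connected_def by blast
  then show thesis
    using that[of p] walk_mono[of "A \<inter> (V - S) \<times> (V - S)" p A] by (auto simp: is_path_from_def is_path_iff)
qed

lemma walk_leaves:
  assumes "walk A p" "hd p \<in> X" "last p \<notin> X"
  shows "\<exists>x\<in>X \<inter> set p. \<exists>y\<in>set p - X. (x, y) \<in> A"
  using assms
proof (induction p)
  case (Cons a p)
  show ?case
  proof (cases "hd p \<in> X")
    case True
    then show ?thesis using Cons by (auto simp: walk_Cons split: if_splits)
  next
    case False
    then have "p \<noteq> []" using Cons.prems by auto
    then show ?thesis using Cons.prems False hd_in_set[of p] by (auto simp: walk_Cons)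
  qed
qed (auto simp: walk_def)

lemma m_strong_terminals:
  assumes "tournament V A" "m_strong m V A" "2 \<le> m" "u \<in> V" "v \<in> V" "u \<noteq> v"
  shows "terminals V A u v"
proof
  fix X assume X: "X \<subseteq> V - {u}" "X \<noteq> {}" "v \<notin> X"
  then obtain x where "x \<in> X" by blast
  then obtain p where "walk A p" "set p \<subseteq> V - {u}" "hd p = x" "last p = v"
    using m_strong_walk[OF assms(2), of "{u}" x v] X assms(3-6) by force
  then show "\<exists>x\<in>X. \<exists>y\<in>V - {u} - X. (x, y) \<in> A" using walk_leaves[of A p X] X \<open>x \<in> X\<close> by blast
next
  fix X assume X: "X \<subseteq> V - {v}" "X \<noteq> {}" "u \<notin> X"
  then obtain x where "x \<in> X" by blast
  then obtain p where "walk A p" "set p \<subseteq> V - {v}" "hd p = u" "last p = x"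
    using m_strong_walk[OF assms(2), of "{v}" u x] X assms(3-6) by force
  \<comment> \<open>The walk runs from outside \<open>X\<close> into \<open>X\<close>, so it is the
    complement that it leaves.\<close>
  then show "\<exists>y\<in>V - {v} - X. \<exists>x\<in>X. (y, x) \<in> A" using walk_leaves[of A p "- X"] X \<open>x \<in> X\<close> by auto
qed (use assms in auto)

text \<open>Menger's theorem in the tournament without \<open>u\<close> and \<open>v\<close>, from
  out-neighbours of \<open>u\<close> to in-neighbours of \<open>v\<close>. One unit of strength pays
  for deleting a terminal together with the separator.\<close>

lemma m_strong_routes:
  assumes T: "tournament V A" and strong: "m_strong (Suc m) V A" and "1 \<le> m"
    and uv: "u \<in> V" "v \<in> V" "u \<noteq> v"
  shows "\<exists>F. terminals.system V A u v F \<and> card F = m"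
proof -
  interpret terminals V A u v using m_strong_terminals[OF T strong] assms by auto
  define W where "W = V - {u, v}"
  define E where "E = A \<inter> W \<times> W"
  define X where "X = {x\<in>W. arc u x}"
  define Y where "Y = {y\<in>W. arc y v}"
  have fin: "finite W" "finite E" "finite X" "E \<subseteq> W \<times> W"
    using finite_V by (auto simp: W_def E_def X_def)
  have "m \<le> card S" if S: "finite S" "separates E X Y S" for S
  proof (rule ccontr)
    assume "\<not> m \<le> card S"
    then have small: "card (S \<inter> W) < m" using S(1) by (meson Int_lower1 card_mono leI le_trans)
    \<comment> \<open>Deleting \<open>v\<close> as well forces an out-neighbour \<open>x\<close> of
      \<open>u\<close> that is neither \<open>v\<close> nor in the separator.\<close>
    define S1 where "S1 = insert v (S \<inter> W)"
    have S1: "S1 \<subseteq> V" "card S1 < Suc m" "u \<notin> S1"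
      using small uv S(1) by (auto simp: S1_def W_def card_insert_if)
    have "\<not> V \<subseteq> insert u S1"
    proof
      assume "V \<subseteq> insert u S1"
      then have "card V \<le> card (insert u S1)" using S(1) by (intro card_mono) (auto simp: S1_def)
      also have "\<dots> \<le> Suc m" using S1 by (metis card_insert_le_m1 diff_Suc_1 less_Suc_eq_le zero_less_Suc)
      finally show False using strong by (simp add: m_strong_def)
    qed
    then obtain z where z: "z \<in> V - S1" "z \<noteq> u" by blast
    obtain p where "walk A p" "set p \<subseteq> V - S1" "hd p = u" "last p = z"
      using m_strong_walk[OF strong S1(1,2), of u z] S1 z uv by blast
    then obtain x where x: "x \<in> V - S1" "x \<noteq> u" "arc u x"
      using walk_leaves[of A p "{u}"] z by blast
    \<comment> \<open>Deleting \<open>u\<close> instead leaves a path from \<open>x\<close> to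
      \<open>v\<close>; without its end \<open>v\<close> it is a walk from \<open>X\<close> to
      \<open>Y\<close> in \<open>E\<close> that avoids \<open>S\<close>.\<close>
    have S2: "insert u (S \<inter> W) \<subseteq> V" "card (insert u (S \<inter> W)) < Suc m"
      using small uv S(1) by (auto simp: W_def card_insert_if)
    obtain q where q: "walk A q" "distinct q" "set q \<subseteq> V - insert u (S \<inter> W)" "hd q = x" "last q = v"
      using m_strong_walk[OF strong S2, of x v] x uv by (auto simp: S1_def W_def)
    define r where "r = butlast q"
    have "q \<noteq> []" using q(1) by (simp add: walk_def)
    then have q_eq: "q = r @ [v]" using q(5) by (metis append_butlast_last_id r_def)
    have "x \<noteq> v" using x by (auto simp: S1_def)
    then have "r \<noteq> []" using q(4) q_eq by auto
    have r: "walk A r" "arc (last r) v" "hd r = x" using q q_eq \<open>r \<noteq> []\<close> by (auto simp: walk_append)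
    have r_W: "set r \<subseteq> W - S" using q q_eq by (auto simp: W_def)
    have "walk E r" using r(1) r_W unfolding walk_def E_def by (auto elim!: successively_mono)
    moreover have "hd r \<in> W" "last r \<in> W" using r_W hd_in_set[OF \<open>r \<noteq> []\<close>] last_in_set[OF \<open>r \<noteq> []\<close>] by blast+
    then have "hd r \<in> X" "last r \<in> Y" using r x by (auto simp: X_def Y_def)
    ultimately show False using S(2) r_W unfolding separates_def by blast
  qed
  then obtain F where F: "linkage E X Y F" "card F = m" using menger[OF fin(2,3)] by blast
  have "route p" if "p \<in> F" for p
  proof -
    have p: "walk E p" "distinct p" "hd p \<in> X" "last p \<in> Y" using F(1) that by (auto simp: linkage_def)
    then have "set p \<subseteq> W" using walk_vertices[OF p(1) fin(4)] by (auto simp: X_def)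
    moreover have "walk A p" using walk_mono[OF p(1)] by (simp add: E_def)
    ultimately show ?thesis using p by (auto simp: route_iff walk_def W_def X_def Y_def)
  qed
  then have "system F" using F(1) by (simp add: system_def linkage_def)
  then show ?thesis using F(2) by blast
qed

lemma (in terminals) container_from_system:
  assumes "arc u v" and F: "system F" "cover F = V - {u, v}" "F \<noteq> {}"
  shows "\<exists>Ps. strong_container (card F + 1) V A u v Ps"
proof -
  have "finite F" using F by (simp add: system_def)
  then obtain Qs where Qs: "set Qs = F" "distinct Qs" using finite_distinct_list by blast
  have len: "length Qs = card F" using distinct_card[OF Qs(2)] Qs(1) by simp
  define f where "f P = u # P @ [v]" for P
  \<comment> \<open>The empty list stands for the arc \<open>uv\<close>, since \<open>f []\<close>
    is \<open>[u, v]\<close>.\<close>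
  define Ps where "Ps = map f ([] # Qs)"
  have route: "route P" if "P \<in> F" for P using that F system_route by blast
  have inj: "inj f" by (rule injI) (simp add: f_def)
  have "[] \<notin> F" using route by (auto simp: route_def)
  then have dist: "distinct ([] # Qs)" using Qs by simp
  have interior_f: "interior (f P) = set P" for P by (simp add: interior_def f_def butlast_append)
  have path: "is_path_from V A u v (f P)" if "P \<in> insert [] F" for P
  proof (cases "P = []")
    case True
    then show ?thesis using assms(1) uv by (auto simp: f_def is_path_from_def is_path_iff walk_def)
  next
    case False
    then show ?thesis using route[of P] that uv
      by (auto simp: f_def is_path_from_def is_path_iff walk_def route_def)
  qed
  have set_Ps: "set Ps = f ` insert [] F" using Qs by (simp add: Ps_def)
  have "strong_container (card F + 1) V A u v Ps"
    unfolding strong_container_def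
  proof (intro conjI allI impI)
    show "length Ps = card F + 1" using len by (simp add: Ps_def)
    show "distinct Ps" unfolding Ps_def distinct_map using dist inj_on_subset[OF inj subset_UNIV] by blast
    show "(\<forall>p\<in>set Ps. is_path_from V A u v p) \<or> (\<forall>p\<in>set Ps. is_path_from V A v u p)"
      using path set_Ps by auto
    show "(\<Union>p\<in>set Ps. set p) = V"
    proof -
      have "(\<Union>p\<in>set Ps. set p) = {u, v} \<union> cover F" unfolding set_Ps by (auto simp: f_def cover_def)
      then show ?thesis using F(2) uv by auto
    qed
    fix i j assume ij: "i < card F + 1" "j < card F + 1" "i \<noteq> j"
    let ?L = "[] # Qs"
    have L: "?L ! i \<in> insert [] F" "?L ! j \<in> insert [] F" "?L ! i \<noteq> ?L ! j"
      using ij len Qs(1) nth_mem[of i ?L] nth_mem[of j ?L] dist nth_eq_iff_index_eq[of ?L i j] by auto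
    have "set (?L ! i) \<inter> set (?L ! j) = {}"
      using L F(1) by (auto simp: system_def pairwise_def simp del: nth_Cons_0)
    moreover have "i < length ?L" "j < length ?L" using ij len by simp_all
    then have "Ps ! i = f (?L ! i)" "Ps ! j = f (?L ! j)" by (simp_all only: Ps_def nth_map)
    ultimately show "interior (Ps ! i) \<inter> interior (Ps ! j) = {}" by (simp add: interior_f)
  qed
  then show ?thesis by blast
qed

theorem theorem3p2:
  fixes V :: "'a set" and A :: "('a \<times> 'a) set" and k :: nat
  assumes "k \<ge> 2"
    and "tournament V A"
    and "m_strong (2 * k + 1) V A"
    and "every_arc_has_2_bypass V A"
  shows "k_star_strongly_connected (k + 1) V A"
proof -
  have container: "\<exists>Ps. strong_container (k + 1) V A u v Ps" if arc_uv: "u \<in> V" "v \<in> V" "u \<noteq> v" "(u, v) \<in> A" for u v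
  proof -
    interpret terminals V A u v using m_strong_terminals[OF assms(2,3)] assms(1) arc_uv by auto
    \<comment> \<open>As \<open>k \<ge> 2\<close>, these are at least \<open>k + 2\<close> routes.
      Absorption and merging end with \<open>k\<close> of them, and the arc \<open>uv\<close> is
      path number \<open>k + 1\<close>.\<close>
    obtain F where "system F" "card F = 2 * k"
      using m_strong_routes[of V A "2 * k" u v] assms arc_uv by auto
    then obtain F' where F': "system F'" "card F' = k + 2" using merge_routes[of F "k + 2"] assms(1) by auto
    then obtain G where G: "system G" "cover G = V - {u, v}" "card G = k"
      using spanning_system[OF F'(1), of k] assms(1) by auto
    have "G \<noteq> {}" using G(3) assms(1) by (metis card.empty not_numeral_le_zero)
    then show ?thesis using container_from_system[OF arc_uv(4) G(1,2)] unfolding G(3) by blast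
  qed
  \<comment> \<open>A container may run in either direction, so whichever of \<open>uv\<close> and
    \<open>vu\<close> is an arc can be used.\<close>
  have swap: "strong_container n V A v u Ps" if "strong_container n V A u v Ps" for n u v Ps
    using that unfolding strong_container_def by blast
  have "\<exists>Ps. strong_container (k + 1) V A u v Ps" if uv: "u \<in> V" "v \<in> V" "u \<noteq> v" for u v
  proof (cases "(u, v) \<in> A")
    case False
    then have "(v, u) \<in> A" using assms(2) uv unfolding tournament_def by blast
    then obtain Ps where "strong_container (k + 1) V A v u Ps" using container[of v u] uv by blast
    then show ?thesis using swap by blast
  qed (use container uv in blast)
  then show ?thesis by (simp add: k_star_strongly_connected_def)
qed

end
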